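(* Let $p\in(1,\infty)$ and $\kappa\ge 1$. Consider the problem $\min_{\mathbf{x}\in\mathbb{R}^m:\ \mathbf{A}\mathbf{x}=\mathbf{b}}\|\mathbf{x}\|_p^p$ with $\mathbf{A}\in\mathbb{R}^{n\times m}$ ($m\ge n$), $\mathbf{b}\in\mathbb{R}^n$, and let $\mathbf{x}^{(0)}=\arg\min_{\mathbf{A}\mathbf{x}=\mathbf{b}}\|\mathbf{x}\|_2^2$. Starting from $\mathbf{x}^{(0)}$, the iterative refinement algorithm described below finds an $\varepsilon$-approximate solution using $O_p\!\left(\kappa\log\frac{m}{\varepsilon}\right)$ calls to a $\kappa$-approximate solver for the residual problem.
   Context: Let $\mathrm{OPT}=\min_{\mathbf{A}\mathbf{x}=\mathbf{b}}\|\mathbf{x}\|_p^p$. A vector $\mathbf{x}$ is an $\varepsilon$-approximate solution if $\mathbf{A}\mathbf{x}=\mathbf{b}$ and $\|\mathbf{x}\|_p^p\le(1+\varepsilon)\mathrm{OPT}$. For $t\ge0$, $p\ge1$, $x\in\mathbb{R}$ define $\gamma_p(t,x)=\frac p2 t^{p-2}x^2$ if $|x|\le t$ and $\gamma_p(t,x)=|x|^p+(\frac p2-1)t^p$ otherwise; for vectors $\gamma_p(\mathbf{t},\mathbf{x})=\sum_i\gamma_p(\mathbf{t}_i,\mathbf{x}_i)$. For a point $\mathbf{x}$, let $\mathbf{g}$ be the gradient of $\|\mathbf{x}\|_p^p$, i.e. $\mathbf{g}_i=p|\mathbf{x}_i|^{p-2}\mathbf{x}_i$, and define $\mathrm{res}(\Delta)=\langle\mathbf{g},\Delta\rangle-\frac{p-1}{p2^p}\gamma_p(|\mathbf{x}|,\Delta)$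 where $|\mathbf{x}|$ is the entrywise absolute value. The residual problem at $\mathbf{x}$ is $\max_{\mathbf{A}\Delta=0}\mathrm{res}(\Delta)$. A $\kappa$-approximate solution to it is $\tilde\Delta$ with $\mathbf{A}\tilde\Delta=0$ and $\mathrm{res}(\tilde\Delta)\ge\frac1\kappa\mathrm{res}(\Delta^\star)$, where $\Delta^\star$ is an optimal solution. The algorithm: set $\lambda=\left(\frac{p-1}{p4^p}\right)^{1/\min\{1,p-1\}}$ and $T=O_p(\kappa\log\frac m\varepsilon)$; for $t=0,\dots,T$, let $\Delta$ be a $\kappa$-approximate solution of the residual problem at $\mathbf{x}^{(t)}$, set $\mathbf{x}^{(t+1)}=\mathbf{x}^{(t)}-\lambda\Delta$, and if $\|\mathbf{x}^{(t+1)}\|_p^p\ge\|\mathbf{x}^{(t)}\|_p^p$ return $\mathbf{x}^{(t)}$; finally return $\mathbf{x}^{(T)}$. The notation $O_p(\cdot)$ hides constant factors depending only on $p$.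
   Formalization: The accuracy is restricted to 0 < ε ≤ 1, and the bound O_p(κ log(m/ε)) on calls is claimed only when m/ε ≥ 2 (otherwise calls ≤ T+1), since log(m/ε) may be zero or negative while the algorithm always makes at least one call. *)

theory Defs
  imports Complex_Main "Jordan_Normal_Form.Matrix"
begin

text \<open>
  Vectors and matrices are those of \<open>Jordan_Normal_Form\<close>, whose dimensions are
  ordinary natural numbers: a constant depending on \<open>p\<close> alone has to be chosen before
  the dimensions \<open>m\<close> and \<open>n\<close>, which rules out dimensions encoded as types.
\<close>

text \<open>\<open>lp_pow p x\<close> is the \<open>p\<close>-th power of the \<open>p\<close>-norm of \<open>x\<close>.\<close>

definition lp_pow :: "real \<Rightarrow> real vec \<Rightarrow> real" where
  "lp_pow p x = (\<Sum>i<dim_vec x. \<bar>x $ i\<bar> powr p)"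

definition feasible :: "real mat \<Rightarrow> real vec \<Rightarrow> real vec set" where
  "feasible A b = {x \<in> carrier_vec (dim_col A). A *\<^sub>v x = b}"

definition OPT :: "real \<Rightarrow> real mat \<Rightarrow> real vec \<Rightarrow> real" where
  "OPT p A b = (INF x \<in> feasible A b. lp_pow p x)"

definition eps_approx_solution ::
  "real \<Rightarrow> real mat \<Rightarrow> real vec \<Rightarrow> real \<Rightarrow> real vec \<Rightarrow> bool" where
  "eps_approx_solution p A b \<epsilon> x \<longleftrightarrow>
     x \<in> feasible A b \<and> lp_pow p x \<le> (1 + \<epsilon>) * OPT p A b"

text \<open>
  Since \<open>0 powr a = 0\<close> for every \<open>a\<close>, the factors \<open>t powr (p - 2)\<close> and
  \<open>\<bar>x $ i\<bar> powr (p - 2)\<close> below are harmless at zero, also for \<open>p \<le> 2\<close>: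
  they are multiplied by zero there.
\<close>

definition gamma_fun :: "real \<Rightarrow> real \<Rightarrow> real \<Rightarrow> real" where
  "gamma_fun p t x =
     (if \<bar>x\<bar> \<le> t then p / 2 * t powr (p - 2) * x\<^sup>2
      else \<bar>x\<bar> powr p + (p / 2 - 1) * t powr p)"

definition gamma_vec :: "real \<Rightarrow> real vec \<Rightarrow> real vec \<Rightarrow> real" where
  "gamma_vec p t x = (\<Sum>i<dim_vec x. gamma_fun p (t $ i) (x $ i))"

definition lp_grad :: "real \<Rightarrow> real vec \<Rightarrow> real vec" where
  "lp_grad p x = vec (dim_vec x) (\<lambda>i. p * \<bar>x $ i\<bar> powr (p - 2) * x $ i)"

definition residual :: "real \<Rightarrow> real vec \<Rightarrow> real vec \<Rightarrow> real" where
  "residual p x \<Delta> =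
     lp_grad p x \<bullet> \<Delta> - (p - 1) / (p * 2 powr p) * gamma_vec p (map_vec abs x) \<Delta>"

definition residual_optimal :: "real \<Rightarrow> real mat \<Rightarrow> real vec \<Rightarrow> real vec \<Rightarrow> bool" where
  "residual_optimal p A x \<Delta> \<longleftrightarrow>
     is_arg_max (residual p x) (\<lambda>\<Delta>. \<Delta> \<in> feasible A (0\<^sub>v (dim_row A))) \<Delta>"

definition residual_approx ::
  "real \<Rightarrow> real mat \<Rightarrow> real \<Rightarrow> real vec \<Rightarrow> real vec \<Rightarrow> bool" where
  "residual_approx p A \<kappa> x \<Delta> \<longleftrightarrow>
     \<Delta> \<in> feasible A (0\<^sub>v (dim_row A)) \<and>
     (\<exists>\<Delta>'. residual_optimal p A x \<Delta>' \<and> residual p x \<Delta> \<ge> 1 / \<kappa> * residual p x \<Delta>')"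

text \<open>
  A solver also receives the number of the current call, so that it need not answer
  two queries at the same point in the same way.
\<close>

definition approx_solver ::
  "real \<Rightarrow> real mat \<Rightarrow> real vec \<Rightarrow> real \<Rightarrow> (nat \<Rightarrow> real vec \<Rightarrow> real vec) \<Rightarrow> bool" where
  "approx_solver p A b \<kappa> solve \<longleftrightarrow>
     (\<forall>t. \<forall>x \<in> feasible A b. residual_approx p A \<kappa> x (solve t x))"

definition step_size :: "real \<Rightarrow> real" where
  "step_size p = ((p - 1) / (p * 4 powr p)) powr (1 / min 1 (p - 1))"

text \<open>
  \<open>refinement_loop p solve T t x\<close> executes the passes \<open>t, \<dots>, T\<close> of the loop from the
  iterate \<open>x\<close> of index \<open>t\<close>; it yields the returned vector and the number of calls to
  \<open>solve\<close>, one per pass. Pass \<open>T\<close> computes the iterate of index \<open>T + 1\<close> for the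
  stopping test, but what is returned after it is the iterate of index \<open>T\<close>.
\<close>

function refinement_loop ::
  "real \<Rightarrow> (nat \<Rightarrow> real vec \<Rightarrow> real vec) \<Rightarrow> nat \<Rightarrow> nat \<Rightarrow> real vec \<Rightarrow> real vec \<times> nat" where
  "refinement_loop p solve T t x =
     (let x' = x - step_size p \<cdot>\<^sub>v solve t x in
      if lp_pow p x' \<ge> lp_pow p x then (x, 1)
      else if t < T then
        (let (y, calls) = refinement_loop p solve T (Suc t) x' in (y, Suc calls))
      else (x, 1))"
  by pat_completeness auto
termination
  by (relation "measure (\<lambda>(p, solve, T, t, x). T - t)") auto

text \<open>The defining equation loops as a rewrite rule.\<close>

declare refinement_loop.simps [simp del]

definition iterative_refinement ::
  "real \<Rightarrow> (nat \<Rightarrow> real vec \<Rightarrow> real vec) \<Rightarrow> nat \<Rightarrow> real vec \<Rightarrow> real vec \<times> nat" where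
  "iterative_refinement p solve T x0 = refinement_loop p solve T 0 x0"

end

theory Submission
  imports Defs "HOL-Analysis.Convex"
begin

text \<open>
  On each coordinate, the deviation of \<open>\<bar>x - \<Delta>\<bar> powr p\<close> from its linearisation at \<open>x\<close> lies
  between \<open>(p - 1) / (p * 2 powr p)\<close> and \<open>2 powr p\<close> times \<open>\<gamma>\<^sub>p(\<bar>x\<bar>, \<Delta>)\<close>. By homogeneity it suffices
  to take \<open>x = 1\<close>, where both bounds follow by comparing derivatives.
  The lower bound shows that the optimal residual is at least the optimality gap.
  The upper bound, together with \<open>\<gamma>\<^sub>p(t, l * \<Delta>) \<le> l powr min 2 p * \<gamma>\<^sub>p(t, \<Delta>)\<close> for \<open>0 < l \<le> 1\<close>,
  shows that a step of size \<open>l = step_size p\<close> gains at least \<open>l\<close> times the residual: the step size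
  is exactly the one that turns the constant \<open>2 powr p\<close> into \<open>(p - 1) / (p * 2 powr p)\<close>.
  Hence each pass shrinks the gap by the factor \<open>1 - l / \<kappa>\<close>, and the loop stops early only at an
  optimum. The initial gap is at most a power of \<open>m\<close> times the optimum, so \<open>O(\<kappa> * ln (m / \<epsilon>))\<close>
  passes are enough.
\<close>

section \<open>Tangent and chord bounds for real powers\<close>

text \<open>Weighted AM-GM for \<open>s\<close> and \<open>1\<close> with weights \<open>q\<close>
  and \<open>1 - q\<close>.\<close>

lemma powr_le_tangent:
  fixes q s :: real
  assumes "0 < q" "q \<le> 1" "0 \<le> s"
  shows "s powr q \<le> 1 + q * (s - 1)"
  using Youngs_inequality_0[of q "1 - q" s 1] assms by (cases "s = 0") (auto simp: algebra_simps)

text \<open>Bernoulli's inequality, from the concave bound with exponent \<open>1 / q\<close> at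
  \<open>s powr q\<close>.\<close>

lemma powr_ge_tangent:
  fixes q s :: real
  assumes "1 \<le> q" "0 \<le> s"
  shows "1 + q * (s - 1) \<le> s powr q"
proof -
  have "(s powr q) powr (1 / q) \<le> 1 + 1 / q * (s powr q - 1)"
    using powr_le_tangent[of "1 / q" "s powr q"] assms by simp
  then show ?thesis
    using assms by (simp add: powr_powr field_simps)
qed

lemma powr_le_chord:
  fixes q u :: real
  assumes "1 \<le> q" "0 \<le> u" "u \<le> 1"
  shows "(1 + u) powr q - 1 \<le> (2 powr q - 1) * u"
proof -
  have "((1 - u) * 1 + u * 2) powr q \<le> (1 - u) * 1 powr q + u * 2 powr q"
    using convex_onD[OF powr_convex[OF assms(1)], of u 1 2] assms by simp
  then show ?thesis by (simp add: algebra_simps)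
qed

lemma powr_le_self:
  fixes q s :: real
  assumes "1 \<le> q" "0 \<le> s" "s \<le> 1"
  shows "s powr q \<le> s"
  using powr_mono'[of 1 q s] assms by simp

lemma self_le_powr:
  fixes q s :: real
  assumes "q \<le> 1" "0 \<le> s" "s \<le> 1"
  shows "s \<le> s powr q"
  using powr_mono'[of q 1 s] assms by simp

text \<open>A concave power lies below its tangent at \<open>s\<close>, here evaluated at
  \<open>1\<close>; this is the tangent bound at \<open>1 / s\<close> multiplied by
  \<open>s powr q\<close>.\<close>

lemma powr_tangent_below:
  fixes q s :: real
  assumes "0 < q" "q \<le> 1" "0 < s"
  shows "q * (s - 1) * s powr (q - 1) \<le> s powr q - 1"
proof -
  have "(1 / s) powr q \<le> 1 + q * (1 / s - 1)"
    using powr_le_tangent[of q "1 / s"] assms by simp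
  then have "s powr q * (1 / s) powr q \<le> s powr q * (1 + q * (1 / s - 1))"
    by (intro mult_left_mono) auto
  then show ?thesis
    using assms by (simp add: powr_divide powr_diff field_simps)
qed

section \<open>Derivative estimates at the unit point\<close>

text \<open>For \<open>q = p - 1\<close>, \<open>p * h\<close> is the derivative of
  \<open>gamma_fun p 1\<close> and \<open>p * ((1 + u) powr q - 1)\<close> that of the deviation
  when the coordinate moves away from zero.\<close>

lemma growth_at_one_bounds:
  fixes q u :: real
  assumes q: "0 < q" and u: "0 < u"
  defines "h \<equiv> (if u < 1 then u else u powr q)"
  shows "min 1 (q / 2) * h \<le> (1 + u) powr q - 1"
    and "(1 + u) powr q - 1 \<le> 2 powr (q + 1) * h"
proof -
  have two: "2 powr (q + 1) = 2 * 2 powr q" "1 \<le> 2 powr q"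
    using q by (auto simp: powr_add ge_one_powr_ge_zero)
  have h0: "0 \<le> h" using u by (simp add: h_def)
  show "min 1 (q / 2) * h \<le> (1 + u) powr q - 1"
  proof (cases "q \<le> 1")
    case True
    \<comment> \<open>The tangent at \<open>1 + u\<close> leaves \<open>(1 + u) powr (q - 1)\<close>
      to be bounded below. For \<open>u < 1\<close> the base is at most \<open>2\<close> and the
      exponent above \<open>-1\<close>; otherwise \<open>1 + u\<close> gives way to
      \<open>2 * u\<close>, as the power decreases.\<close>
    have "q / 2 * h \<le> q * (u * (1 + u) powr (q - 1))"
    proof (cases "u < 1")
      case u1: True
      have "1 / 2 = 2 powr (- 1 :: real)" by (simp add: powr_minus_divide)
      also have "\<dots> \<le> (1 + u) powr (- 1)"
        using u u1 by (intro powr_mono2') auto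
      also have "\<dots> \<le> (1 + u) powr (q - 1)"
        using u q by (intro powr_mono) auto
      finally have "u * (1 / 2) \<le> u * (1 + u) powr (q - 1)"
        using u by (intro mult_left_mono) auto
      then show ?thesis using q u1 by (simp add: h_def)
    next
      case u1: False
      have "1 / 2 \<le> 2 powr (q - 1)"
        using powr_mono[of "- 1" "q - 1" "2 :: real"] q by (simp add: powr_minus_divide)
      then have "u powr q * (1 / 2) \<le> u powr q * 2 powr (q - 1)"
        by (intro mult_left_mono) auto
      also have "\<dots> = u * (2 * u) powr (q - 1)"
        using u by (simp add: powr_mult powr_diff)
      also have "\<dots> \<le> u * (1 + u) powr (q - 1)"
        using u u1 True by (intro mult_left_mono powr_mono2') auto
      finally show ?thesis using q u1 by (simp add: h_def)
    qed
    also have "\<dots> \<le> (1 + u) powr q - 1"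
      using powr_tangent_below[of q "1 + u"] q True u by (simp add: mult.assoc)
    finally show ?thesis using True by (simp add: min_def)
  next
    case False
    have "h \<le> (1 + u) powr q - 1"
    proof (cases "u < 1")
      case True
      have "u \<le> q * u" using u False by simp
      moreover have "1 + q * u \<le> (1 + u) powr q"
        using powr_ge_tangent[of q "1 + u"] False u by simp
      ultimately show ?thesis using True unfolding h_def by simp
    next
      case u1: False
      \<comment> \<open>Superadditivity: the two fractions sum to \<open>1\<close>, and an exponent
        above \<open>1\<close> does not increase them.\<close>
      have "(1 / (1 + u)) powr q + (u / (1 + u)) powr q \<le> 1 / (1 + u) + u / (1 + u)"
        using False u by (intro add_mono powr_le_self) auto
      also have "\<dots> = 1" using u by (simp add: add_divide_distrib[symmetric])
      finally have "1 + u powr q \<le> (1 + u) powr q"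
        using u by (simp add: powr_divide field_simps)
      then show ?thesis using u1 by (simp add: h_def)
    qed
    moreover have "min 1 (q / 2) * h \<le> 1 * h"
      using h0 by (intro mult_right_mono) auto
    ultimately show ?thesis by simp
  qed
  show "(1 + u) powr q - 1 \<le> 2 powr (q + 1) * h"
  proof (cases "u < 1")
    case u1: True
    have "(1 + u) powr q - 1 \<le> 2 powr q * u"
    proof (cases "q \<le> 1")
      case True
      have "(1 + u) powr q - 1 \<le> q * u" using powr_le_tangent[of q "1 + u"] True q u by simp
      also have "\<dots> \<le> 2 powr q * u" using two True u by (intro mult_right_mono) auto
      finally show ?thesis .
    next
      case False
      then show ?thesis using powr_le_chord[of q u] u u1 by (simp add: algebra_simps)
    qed
    also have "\<dots> \<le> 2 powr (q + 1) * u" using two u by (intro mult_right_mono) auto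
    finally show ?thesis using u1 by (simp add: h_def)
  next
    case u1: False
    have "(1 + u) powr q \<le> (2 * u) powr q" using q u u1 by (intro powr_mono2) auto
    also have "\<dots> = 2 powr q * u powr q" using u by (simp add: powr_mult)
    also have "\<dots> \<le> 2 powr (q + 1) * u powr q" using two by (intro mult_right_mono) auto
    finally show ?thesis using u1 by (simp add: h_def)
  qed
qed

text \<open>The derivative estimates for a coordinate moving towards zero. In each bound, the
  tangent and monotonicity in the exponent change roles at \<open>q = 1\<close>.\<close>

lemma decay_at_one_bounds_near:
  fixes q v :: real
  assumes q: "0 < q" and v: "0 \<le> v" "v \<le> 1"
  shows "min 1 q * v \<le> 1 - (1 - v) powr q" and "1 - (1 - v) powr q \<le> max 1 q * v"
proof -
  show "min 1 q * v \<le> 1 - (1 - v) powr q"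
    using powr_le_tangent[of q "1 - v"] powr_le_self[of q "1 - v"] assms
    by (cases "q \<le> 1") (auto simp: min_def)
  show "1 - (1 - v) powr q \<le> max 1 q * v"
    using powr_ge_tangent[of q "1 - v"] self_le_powr[of q "1 - v"] assms
    by (cases "q \<le> 1") (auto simp: max_def)
qed

text \<open>Past zero the two terms of the derivative add up; the larger of \<open>1\<close> and
  \<open>v - 1\<close> is at least \<open>v / 2\<close>.\<close>

lemma decay_at_one_bounds_far:
  fixes q v :: real
  assumes q: "0 < q" and v: "1 \<le> v"
  shows "2 powr (- q) * v powr q \<le> 1 + (v - 1) powr q" and "1 + (v - 1) powr q \<le> 2 * v powr q"
proof -
  have "(v / 2) powr q \<le> (max 1 (v - 1)) powr q"
    using q v by (intro powr_mono2) (auto simp: max_def)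
  also have "\<dots> \<le> 1 + (v - 1) powr q" by (simp add: max_def)
  finally show "2 powr (- q) * v powr q \<le> 1 + (v - 1) powr q"
    using v by (simp add: powr_divide powr_minus_divide)
  have "1 \<le> v powr q" using v q by (simp add: ge_one_powr_ge_zero)
  moreover have "(v - 1) powr q \<le> v powr q" using v q by (intro powr_mono2) auto
  ultimately show "1 + (v - 1) powr q \<le> 2 * v powr q" by simp
qed

section \<open>The function gamma: comparison and scaling\<close>

text \<open>Both sides vanish at \<open>0\<close>, so ordered derivatives suffice, first up to
  \<open>1\<close> and then from there. The sign of \<open>c\<close> is free: applied to
  \<open>- E\<close>, the lemma yields upper bounds.\<close>

lemma gamma_le_by_derivative:
  fixes p c :: real and E E' :: "real \<Rightarrow> real"
  assumes p: "1 < p" and E0: "E 0 = 0" and cont: "continuous_on {0..} E"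
    and der: "\<And>u. 0 < u \<Longrightarrow> u \<noteq> 1 \<Longrightarrow> (E has_real_derivative E' u) (at u)"
    and le: "\<And>u. 0 < u \<Longrightarrow> u \<noteq> 1 \<Longrightarrow> c * (p * (if u < 1 then u else u powr (p - 1))) \<le> E' u"
    and u: "0 \<le> u"
  shows "c * gamma_fun p 1 u \<le> E u"
proof -
  have near: "c * gamma_fun p 1 u \<le> E u" if u: "0 \<le> u" "u \<le> 1" for u
  proof -
    let ?D = "\<lambda>u. E u - c * (p / 2 * u\<^sup>2)"
    have "?D 0 \<le> ?D u"
    proof (rule DERIV_nonneg_imp_increasing_open[OF u(1)])
      fix s assume s: "0 < s" "s < u"
      have "(?D has_real_derivative E' s - c * (p * s)) (at s)"
        using s u by (auto intro!: derivative_eq_intros der)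
      moreover have "c * (p * s) \<le> E' s" using le[of s] s u by simp
      ultimately show "\<exists>y. DERIV ?D s :> y \<and> y \<ge> 0" by (intro exI[of _ "E' s - c * (p * s)"]) auto
    next
      show "continuous_on {0..u} ?D"
        by (intro continuous_intros continuous_on_subset[OF cont]) auto
    qed
    then show ?thesis using E0 u by (simp add: gamma_fun_def)
  qed
  show ?thesis
  proof (cases "u \<le> 1")
    case True
    then show ?thesis using near u by simp
  next
    case False
    \<comment> \<open>Beyond \<open>1\<close>, the constant \<open>p / 2 - 1\<close> in gamma
      cancels against the value at \<open>1\<close>.\<close>
    let ?D = "\<lambda>u. E u - c * (u powr p)"
    have "?D 1 \<le> ?D u"
    proof (rule DERIV_nonneg_imp_increasing_open[of 1 u ?D])
      show "1 \<le> u" using False by simp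
      fix s assume s: "1 < s" "s < u"
      have "(?D has_real_derivative E' s - c * (p * s powr (p - 1))) (at s)"
        using s by (auto intro!: derivative_eq_intros der)
      moreover have "c * (p * s powr (p - 1)) \<le> E' s" using le[of s] s by simp
      ultimately show "\<exists>y. DERIV ?D s :> y \<and> y \<ge> 0"
        by (intro exI[of _ "E' s - c * (p * s powr (p - 1))"]) auto
    next
      show "continuous_on {1..u} ?D"
        by (intro continuous_intros continuous_on_subset[OF cont]) auto
    qed
    then show ?thesis using near[of 1] False by (simp add: gamma_fun_def algebra_simps)
  qed
qed


lemma gamma_fun_minus [simp]: "gamma_fun p t (- x) = gamma_fun p t x"
  by (simp add: gamma_fun_def)

lemma gamma_fun_abs [simp]: "gamma_fun p t \<bar>x\<bar> = gamma_fun p t x"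
  by (simp add: gamma_fun_def)

text \<open>The case that scaling from \<open>t = 1\<close> does not reach.\<close>

lemma gamma_fun_zero_left: "gamma_fun p 0 x = \<bar>x\<bar> powr p"
  by (simp add: gamma_fun_def)

lemma gamma_fun_scale:
  assumes "0 < t"
  shows "gamma_fun p t (t * x) = t powr p * gamma_fun p 1 x"
proof -
  have "t powr p = t powr (p - 2) * t\<^sup>2"
    using assms by (simp add: powr_diff)
  then show ?thesis
    using assms by (auto simp: gamma_fun_def abs_mult powr_mult power_mult_distrib algebra_simps)
qed

section \<open>Deviation of the power from its linearisation\<close>

text \<open>The derivative estimates ask for these: \<open>(p - 1) / 2\<close> and \<open>1\<close>
  when moving away from zero or before reaching it, \<open>2 powr (1 - p)\<close> past it, and the
  last two for the upper bounds.\<close>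

lemma residual_constant_bounds:
  fixes p :: real
  assumes p: "1 < p"
  defines "c \<equiv> (p - 1) / (p * 2 powr p)"
  shows "0 \<le> c" "c \<le> 1" "c \<le> (p - 1) / 2" "c \<le> 2 powr (1 - p)"
    and "p \<le> 2 powr p" "2 \<le> 2 powr p"
proof -
  show two: "2 \<le> 2 powr p" using powr_mono[of 1 p 2] p by simp
  show "p \<le> 2 powr p" using powr_ge_tangent[of p 2] p by simp
  show "0 \<le> c" using p by (simp add: c_def)
  have "2 \<le> p * 2 powr p" using mult_mono[of 1 p 2 "2 powr p"] p two by simp
  then show "c \<le> (p - 1) / 2" using p unfolding c_def by (intro divide_left_mono) auto
  have "c = (p - 1) / p * (1 / 2 powr p)" by (simp add: c_def)
  also have "\<dots> \<le> 1 * (1 / 2 powr p)" using p by (intro mult_right_mono) auto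
  finally have c: "c \<le> 1 / 2 powr p" by simp
  also have "\<dots> \<le> 2 powr (1 - p)" by (simp add: powr_diff divide_right_mono)
  finally show "c \<le> 2 powr (1 - p)" .
  have "1 / 2 powr p \<le> 1" using two by simp
  then show "c \<le> 1" using c by linarith
qed

text \<open>The case of a unit coordinate with \<open>\<Delta> = - u\<close>, moving away from
  zero.\<close>

lemma abs_powr_deviation_unit_pos:
  fixes p u :: real
  assumes p: "1 < p" and u: "0 \<le> u"
  defines "c \<equiv> (p - 1) / (p * 2 powr p)"
  shows "c * gamma_fun p 1 u \<le> (1 + u) powr p - 1 - p * u" (is ?lower)
    and "(1 + u) powr p - 1 - p * u \<le> 2 powr p * gamma_fun p 1 u" (is ?upper)
proof -
  note cb = residual_constant_bounds[OF p, folded c_def]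
  let ?E = "\<lambda>u. (1 + u) powr p - 1 - p * u"
  let ?E' = "\<lambda>u. p * ((1 + u) powr (p - 1) - 1)"
  let ?h = "\<lambda>u. if u < 1 then u else u powr (p - 1)"
  have cont: "continuous_on {0..} ?E"
    by (intro continuous_intros) auto
  have der: "(?E has_real_derivative ?E' s) (at s)" if "0 < s" for s
    using that by (auto intro!: derivative_eq_intros simp: algebra_simps)
  have lower: "c * (p * ?h s) \<le> ?E' s" if s: "0 < s" for s
  proof -
    have "c * ?h s \<le> min 1 ((p - 1) / 2) * ?h s"
      using cb s by (intro mult_right_mono) auto
    also have "\<dots> \<le> (1 + s) powr (p - 1) - 1"
      using growth_at_one_bounds(1)[of "p - 1" s] p s by simp
    finally show ?thesis using p by (simp add: mult.left_commute)
  qed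
  have upper: "?E' s \<le> 2 powr p * (p * ?h s)" if s: "0 < s" for s
    using mult_left_mono[OF growth_at_one_bounds(2)[of "p - 1" s], of p] p s
    by (simp add: mult.left_commute)
  show ?lower
    by (rule gamma_le_by_derivative[OF p _ cont der lower u]) auto
  \<comment> \<open>The upper bound is the comparison for \<open>- ?E\<close> with a negative
    constant.\<close>
  have "(- (2 powr p)) * gamma_fun p 1 u \<le> - ?E u"
  proof (rule gamma_le_by_derivative[OF p _ _ _ _ u, where E' = "\<lambda>u. - ?E' u"])
    show "((\<lambda>u. - ?E u) has_real_derivative - ?E' s) (at s)" if "0 < s" for s
      using DERIV_minus[OF der[OF that]] by simp
    show "(- (2 powr p)) * (p * ?h s) \<le> - ?E' s" if "0 < s" for s
      using upper[OF that] by simp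
  qed (use cont in \<open>auto intro: continuous_on_minus[OF cont, simplified]\<close>)
  then show ?upper by simp
qed

text \<open>The case of a unit coordinate with \<open>\<Delta> = u\<close>, which crosses zero at
  \<open>u = 1\<close>; the derivative is therefore computed on either side.\<close>

lemma abs_powr_deviation_unit_neg:
  fixes p u :: real
  assumes p: "1 < p" and u: "0 \<le> u"
  defines "c \<equiv> (p - 1) / (p * 2 powr p)"
  shows "c * gamma_fun p 1 u \<le> \<bar>1 - u\<bar> powr p - 1 + p * u" (is ?lower)
    and "\<bar>1 - u\<bar> powr p - 1 + p * u \<le> 2 powr p * gamma_fun p 1 u" (is ?upper)
proof -
  note cb = residual_constant_bounds[OF p, folded c_def]
  let ?E = "\<lambda>u. \<bar>1 - u\<bar> powr p - 1 + p * u"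
  let ?e = "\<lambda>u. if u < 1 then 1 - (1 - u) powr (p - 1) else 1 + (u - 1) powr (p - 1)"
  let ?E' = "\<lambda>u. p * ?e u"
  let ?h = "\<lambda>u. if u < 1 then u else u powr (p - 1)"
  have cont: "continuous_on {0..} ?E"
    using p by (intro continuous_intros continuous_on_powr') auto
  have der: "(?E has_real_derivative ?E' s) (at s)" if s: "0 < s" "s \<noteq> 1" for s
  proof (cases "s < 1")
    case True
    have "((\<lambda>u. (1 - u) powr p - 1 + p * u) has_real_derivative ?E' s) (at s)"
      using True by (auto intro!: derivative_eq_intros simp: algebra_simps)
    then show ?thesis
      by (rule has_field_derivative_transform_within_open[where S = "{..<1}"]) (use True in auto)
  next
    case False
    then have "1 < s" using s by simp
    then have "((\<lambda>u. (u - 1) powr p - 1 + p * u) has_real_derivative ?E' s) (at s)"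
      by (auto intro!: derivative_eq_intros simp: algebra_simps)
    then show ?thesis
      by (rule has_field_derivative_transform_within_open[where S = "{1<..}"]) (use \<open>1 < s\<close> in auto)
  qed
  have lower_e: "c * ?h s \<le> ?e s" if s: "0 < s" for s
  proof (cases "s < 1")
    case True
    have "c * s \<le> min 1 (p - 1) * s" using cb p s by (intro mult_right_mono) auto
    also have "\<dots> \<le> 1 - (1 - s) powr (p - 1)"
      using decay_at_one_bounds_near(1)[of "p - 1" s] True p s by simp
    finally show ?thesis using True by simp
  next
    case False
    have "c * s powr (p - 1) \<le> 2 powr (1 - p) * s powr (p - 1)"
      using cb by (intro mult_right_mono) auto
    also have "\<dots> \<le> 1 + (s - 1) powr (p - 1)"
      using decay_at_one_bounds_far(1)[of "p - 1" s] False p by simp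
    finally show ?thesis using False by simp
  qed
  have upper_e: "?e s \<le> 2 powr p * ?h s" if s: "0 < s" for s
  proof (cases "s < 1")
    case True
    have "1 - (1 - s) powr (p - 1) \<le> max 1 (p - 1) * s"
      using decay_at_one_bounds_near(2)[of "p - 1" s] True p s by simp
    also have "\<dots> \<le> 2 powr p * s" using cb s by (intro mult_right_mono) auto
    finally show ?thesis using True by simp
  next
    case False
    have "1 + (s - 1) powr (p - 1) \<le> 2 * s powr (p - 1)"
      using decay_at_one_bounds_far(2)[of "p - 1" s] False p by simp
    also have "\<dots> \<le> 2 powr p * s powr (p - 1)" using cb by (intro mult_right_mono) auto
    finally show ?thesis using False by simp
  qed
  have lower: "c * (p * ?h s) \<le> ?E' s" if "0 < s" for s
    using mult_left_mono[OF lower_e[OF that], of p] p by (simp only: mult.left_commute)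
  have upper: "(- (2 powr p)) * (p * ?h s) \<le> - ?E' s" if "0 < s" for s
    using mult_left_mono[OF upper_e[OF that], of p] p
    by (simp only: mult.left_commute[of p] minus_mult_left[symmetric] neg_le_iff_le)
  show ?lower
    by (rule gamma_le_by_derivative[OF p _ cont der lower u]) auto
  have "(- (2 powr p)) * gamma_fun p 1 u \<le> - ?E u"
    by (rule gamma_le_by_derivative[OF p _ continuous_on_minus[OF cont] DERIV_minus[OF der] upper u]) auto
  then show ?upper by simp
qed

lemma abs_powr_deviation_bounds:
  fixes p x \<Delta> :: real
  assumes p: "1 < p"
  defines "D \<equiv> \<bar>x - \<Delta>\<bar> powr p - \<bar>x\<bar> powr p + p * \<bar>x\<bar> powr (p - 2) * x * \<Delta>"
  shows "(p - 1) / (p * 2 powr p) * gamma_fun p \<bar>x\<bar> \<Delta> \<le> D" (is "?c * _ \<le> _")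
    and "D \<le> 2 powr p * gamma_fun p \<bar>x\<bar> \<Delta>"
proof -
  note cb = residual_constant_bounds[OF p]
  have unit: "?c * gamma_fun p 1 u \<le> \<bar>1 - u\<bar> powr p - 1 + p * u \<and>
      \<bar>1 - u\<bar> powr p - 1 + p * u \<le> 2 powr p * gamma_fun p 1 u" for u
    using abs_powr_deviation_unit_neg[OF p, of u] abs_powr_deviation_unit_pos[OF p, of "- u"]
    by (cases "0 \<le> u") auto
  have "?c * gamma_fun p \<bar>x\<bar> \<Delta> \<le> D \<and> D \<le> 2 powr p * gamma_fun p \<bar>x\<bar> \<Delta>"
  proof (cases "x = 0")
    case True
    \<comment> \<open>At a zero coordinate the linear term vanishes, and both the deviation and
      gamma equal \<open>\<bar>\<Delta>\<bar> powr p\<close>.\<close>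
    have "?c * \<bar>\<Delta>\<bar> powr p \<le> 1 * \<bar>\<Delta>\<bar> powr p" "1 * \<bar>\<Delta>\<bar> powr p \<le> 2 powr p * \<bar>\<Delta>\<bar> powr p"
      using cb by (intro mult_right_mono; simp)+
    then show ?thesis using True p by (simp add: D_def gamma_fun_zero_left)
  next
    case False
    \<comment> \<open>Dividing by \<open>x\<close> itself, not by its absolute value, makes
      \<open>u\<close> positive exactly when the step points towards zero.\<close>
    define u where "u = \<Delta> / x"
    have \<Delta>: "\<Delta> = x * u" using False by (simp add: u_def)
    have "gamma_fun p \<bar>x\<bar> \<Delta> = gamma_fun p \<bar>x\<bar> (\<bar>x\<bar> * u)"
      by (cases "0 \<le> x") (auto simp: \<Delta>)
    then have \<gamma>: "gamma_fun p \<bar>x\<bar> \<Delta> = \<bar>x\<bar> powr p * gamma_fun p 1 u"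
      using False by (simp add: gamma_fun_scale)
    have "p * \<bar>x\<bar> powr (p - 2) * x * \<Delta> = (\<bar>x\<bar> powr (p - 2) * x\<^sup>2) * (p * u)"
      by (simp add: \<Delta> power2_eq_square)
    also have "\<bar>x\<bar> powr (p - 2) * x\<^sup>2 = \<bar>x\<bar> powr p"
      using False by (simp add: powr_diff)
    finally have "p * \<bar>x\<bar> powr (p - 2) * x * \<Delta> = \<bar>x\<bar> powr p * (p * u)" .
    moreover have "x - \<Delta> = x * (1 - u)" by (simp add: \<Delta> algebra_simps)
    then have "\<bar>x - \<Delta>\<bar> powr p = \<bar>x\<bar> powr p * \<bar>1 - u\<bar> powr p"
      by (simp only: abs_mult) (simp add: powr_mult)
    ultimately have "D = \<bar>x\<bar> powr p * (\<bar>1 - u\<bar> powr p - 1 + p * u)"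
      unfolding D_def by (simp add: algebra_simps)
    then show ?thesis
      using mult_left_mono[OF conjunct1[OF unit], of "\<bar>x\<bar> powr p" u]
        mult_left_mono[OF conjunct2[OF unit], of "\<bar>x\<bar> powr p" u]
      by (simp add: \<gamma> mult.left_commute)
  qed
  then show "?c * gamma_fun p \<bar>x\<bar> \<Delta> \<le> D" "D \<le> 2 powr p * gamma_fun p \<bar>x\<bar> \<Delta>" by auto
qed


section \<open>Contraction of gamma and the step size\<close>

text \<open>The exponent is \<open>min 2 p\<close>, the slower of the quadratic and the power rate.
  The cases record which branch of gamma applies at \<open>y\<close> and at
  \<open>l * y\<close>.\<close>

lemma gamma_fun_unit_contract:
  fixes p l y :: real
  assumes p: "1 < p" and l: "0 < l" "l \<le> 1" and y: "0 \<le> y"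
  shows "gamma_fun p 1 (l * y) \<le> l powr (1 + min 1 (p - 1)) * gamma_fun p 1 y"
proof -
  let ?L = "l powr (1 + min 1 (p - 1))"
  have L2: "l\<^sup>2 \<le> ?L"
    using l powr_mono'[of "1 + min 1 (p - 1)" 2 l] by simp
  have ly: "l * y \<le> y" using l y mult_right_mono[of l 1 y] by simp
  consider (near) "y \<le> 1" | (mid) "1 < y" "l * y \<le> 1" | (far) "1 < l * y" "1 < y"
    using ly by linarith
  then show ?thesis
  proof cases
    case near
    have "p / 2 * y\<^sup>2 * l\<^sup>2 \<le> p / 2 * y\<^sup>2 * ?L"
      using L2 p by (intro mult_left_mono) auto
    then show ?thesis
      using near ly l y by (simp add: gamma_fun_def power_mult_distrib algebra_simps)
  next
    case mid
    have "p / 2 * (l * y)\<^sup>2 \<le> ?L * (y powr p + (p / 2 - 1))"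
    proof (cases "2 \<le> p")
      case True
      \<comment> \<open>Bernoulli in \<open>y\<^sup>2\<close> shows that the quadratic branch,
        continued beyond \<open>1\<close>, stays below gamma.\<close>
      have "1 + p / 2 * (y\<^sup>2 - 1) \<le> (y\<^sup>2) powr (p / 2)"
        using True by (intro powr_ge_tangent) auto
      also have "\<dots> = y powr p" using powr_powr[of y 2 "p / 2"] y by simp
      finally have "p / 2 * y\<^sup>2 \<le> y powr p + (p / 2 - 1)" by (simp add: algebra_simps)
      then have "l\<^sup>2 * (p / 2 * y\<^sup>2) \<le> l\<^sup>2 * (y powr p + (p / 2 - 1))"
        by (intro mult_left_mono) auto
      moreover have "?L = l\<^sup>2" using True l by (simp add: min_def)
      ultimately show ?thesis by (simp add: power_mult_distrib algebra_simps)
    next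
      case False
      have L: "?L = l powr p" using False by (simp add: min_def)
      \<comment> \<open>Since \<open>l * y \<le> 1\<close>, the square is below the power; the
        weight \<open>1 - p / 2\<close> then trades \<open>(l * y) powr p\<close> for the smaller
        \<open>l powr p\<close>.\<close>
      have "(l * y)\<^sup>2 \<le> (l * y) powr p"
        using mid l y False powr_mono'[of p 2 "l * y"] by simp
      then have "p / 2 * (l * y)\<^sup>2 \<le> p / 2 * (l * y) powr p"
        using p by (intro mult_left_mono) auto
      moreover have "(1 - p / 2) * l powr p \<le> (1 - p / 2) * (l * y) powr p"
        using l mid p False by (intro mult_left_mono powr_mono2) auto
      ultimately have "p / 2 * (l * y)\<^sup>2 \<le> (l * y) powr p - (1 - p / 2) * l powr p"
        by (simp add: algebra_simps)
      then show ?thesis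
        unfolding L using l y by (simp add: powr_mult algebra_simps)
    qed
    then show ?thesis using mid l y by (simp add: gamma_fun_def)
  next
    case far
    have "l powr p * y powr p + (p / 2 - 1) \<le> ?L * (y powr p + (p / 2 - 1))"
    proof (cases "2 \<le> p")
      case True
      have L: "?L = l powr 2" using True l by (simp add: min_def)
      \<comment> \<open>Since \<open>(l * y) powr p \<ge> 1\<close>, the tangent bound for \<open>l powr (2 - p)\<close> is enough.\<close>
      define a where "a = p - 2"
      have a: "0 \<le> a" using True by (simp add: a_def)
      have "1 + (- a) * ln l \<le> exp ((- a) * ln l)" by (rule exp_ge_add_one_self)
      also have "\<dots> = l powr (- a)" using l by (simp add: powr_def)
      finally have "- (a * ln l) \<le> l powr (- a) - 1" by simp
      moreover have "(1 - l powr 2) / 2 \<le> - ln l"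
        using ln_le_minus_one[of "l powr 2"] ln_powr[of l 2] l by simp
      then have "a * ((1 - l powr 2) / 2) \<le> a * (- ln l)" using a by (intro mult_left_mono) auto
      ultimately have key: "a / 2 * (1 - l powr 2) \<le> l powr (- a) - 1" by simp
      also have "\<dots> \<le> (l powr (- a) - 1) * (l * y) powr p"
        using far p l a ge_one_powr_ge_zero[of "l * y" p] powr_mono'[of "- a" 0 l]
        by (intro mult_le_cancel_left1[THEN iffD2]) auto
      also have "\<dots> = l powr 2 * y powr p - l powr p * y powr p"
        using l y by (simp add: powr_mult a_def powr_diff algebra_simps)
      finally show ?thesis unfolding L by (simp add: a_def field_simps)
    next
      case False
      have L: "?L = l powr p" using False by (simp add: min_def)
      \<comment> \<open>For \<open>p < 2\<close> the constant \<open>p / 2 - 1\<close> is negative,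
        so the factor \<open>l powr p\<close> can only raise it.\<close>
      have "(1 - p / 2) * l powr p \<le> (1 - p / 2) * 1"
        using False l p by (intro mult_left_mono powr_le1) auto
      then show ?thesis unfolding L by (simp add: algebra_simps)
    qed
    then show ?thesis using far l y by (simp add: gamma_fun_def powr_mult)
  qed
qed

lemma gamma_fun_contract:
  fixes p l t x :: real
  assumes p: "1 < p" and l: "0 < l" "l \<le> 1" and t: "0 \<le> t"
  shows "gamma_fun p t (l * x) \<le> l powr (1 + min 1 (p - 1)) * gamma_fun p t x"
proof (cases "t = 0")
  case True
  have "l powr p \<le> l powr (1 + min 1 (p - 1))" using l by (intro powr_mono') auto
  then show ?thesis
    using True l by (simp add: gamma_fun_zero_left abs_mult powr_mult mult_right_mono)
next
  case False
  \<comment> \<open>The free factor \<open>k\<close> serves both sides of the claim, with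
    \<open>k = l\<close> and \<open>k = 1\<close>.\<close>
  have x: "gamma_fun p t (k * x) = t powr p * gamma_fun p 1 (k * (\<bar>x\<bar> / t))" if "0 \<le> k" for k
  proof -
    have "gamma_fun p t (k * x) = gamma_fun p t (t * (k * (\<bar>x\<bar> / t)))"
      using gamma_fun_abs[of p t "k * x"] False that by (simp add: abs_mult)
    also have "\<dots> = t powr p * gamma_fun p 1 (k * (\<bar>x\<bar> / t))"
      using t False by (intro gamma_fun_scale) simp
    finally show ?thesis .
  qed
  have "t powr p * gamma_fun p 1 (l * (\<bar>x\<bar> / t))
      \<le> t powr p * (l powr (1 + min 1 (p - 1)) * gamma_fun p 1 (\<bar>x\<bar> / t))"
    using t by (intro mult_left_mono gamma_fun_unit_contract[OF p l]) auto
  then show ?thesis using x[of l] x[of 1] l by (simp add: mult.left_commute)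
qed

lemma step_size_bounds:
  assumes "1 < p"
  shows "0 < step_size p" "step_size p \<le> 1"
proof -
  have "1 \<le> 4 powr p" using assms by (simp add: ge_one_powr_ge_zero)
  then have "p * 1 \<le> p * 4 powr p" using assms by (intro mult_left_mono) auto
  then have "p - 1 \<le> p * 4 powr p" by simp
  then show "0 < step_size p" "step_size p \<le> 1"
    using assms by (auto simp: step_size_def divide_le_eq intro!: powr_le1)
qed

text \<open>The root in \<open>step_size\<close> cancels. One factor of
  \<open>4 powr p = 2 powr p * 2 powr p\<close> absorbs the upper deviation constant, the other
  remains in the residual constant.\<close>

lemma step_size_powr:
  assumes "1 < p"
  shows "2 powr p * step_size p powr (1 + min 1 (p - 1)) = step_size p * ((p - 1) / (p * 2 powr p))"
proof -
  have "step_size p powr min 1 (p - 1) = (p - 1) / (p * 4 powr p)"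
  proof -
    have "min 1 (p - 1) \<noteq> 0" using assms by (simp add: min_def)
    then show ?thesis using assms by (simp add: step_size_def powr_powr)
  qed
  moreover have "4 powr p = 2 powr p * 2 powr p"
    using powr_mult[of 2 2 p] by simp
  ultimately show ?thesis
    using step_size_bounds[OF assms] by (simp add: powr_add)
qed

section \<open>The residual against the change of the norm\<close>

lemma residual_sum:
  assumes "x \<in> carrier_vec m" "\<Delta> \<in> carrier_vec m"
  shows "residual p x \<Delta> = (\<Sum>i<m. p * \<bar>x $ i\<bar> powr (p - 2) * x $ i * \<Delta> $ i
           - (p - 1) / (p * 2 powr p) * gamma_fun p \<bar>x $ i\<bar> (\<Delta> $ i))"
  using assms
  by (auto simp: residual_def scalar_prod_def lp_grad_def gamma_vec_def lessThan_atLeast0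
      sum_subtractf sum_distrib_left)

lemma lp_pow_sum: "x \<in> carrier_vec m \<Longrightarrow> lp_pow p x = (\<Sum>i<m. \<bar>x $ i\<bar> powr p)"
  by (auto simp: lp_pow_def)

lemma lp_pow_nonneg: "0 \<le> lp_pow p x"
  by (auto simp: lp_pow_def intro: sum_nonneg)

text \<open>Sums the lower deviation bound for \<open>\<Delta> = x - y\<close>, the step leading
  from \<open>x\<close> to the competitor \<open>y\<close>.\<close>

lemma lp_pow_diff_le_residual:
  assumes p: "1 < p" and x: "x \<in> carrier_vec m" and y: "y \<in> carrier_vec m"
  shows "lp_pow p x - lp_pow p y \<le> residual p x (x - y)"
proof -
  have "lp_pow p x - lp_pow p y = (\<Sum>i<m. \<bar>x $ i\<bar> powr p - \<bar>y $ i\<bar> powr p)"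
    using x y by (simp add: lp_pow_sum sum_subtractf)
  also have "\<dots> \<le> residual p x (x - y)"
    unfolding residual_sum[OF x minus_carrier_vec[OF x y]]
  proof (rule sum_mono)
    fix i assume "i \<in> {..<m}"
    then show "\<bar>x $ i\<bar> powr p - \<bar>y $ i\<bar> powr p \<le> p * \<bar>x $ i\<bar> powr (p - 2) * x $ i * (x - y) $ i
        - (p - 1) / (p * 2 powr p) * gamma_fun p \<bar>x $ i\<bar> ((x - y) $ i)"
      using abs_powr_deviation_bounds(1)[OF p, of "x $ i" "x $ i - y $ i"] x y by simp
  qed
  finally show ?thesis .
qed

lemma lp_pow_step_le:
  assumes p: "1 < p" and x: "x \<in> carrier_vec m" and d: "\<Delta> \<in> carrier_vec m"
  shows "lp_pow p (x - step_size p \<cdot>\<^sub>v \<Delta>) \<le> lp_pow p x - step_size p * residual p x \<Delta>"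
proof -
  let ?l = "step_size p"
  have "lp_pow p (x - ?l \<cdot>\<^sub>v \<Delta>) = (\<Sum>i<m. \<bar>x $ i - ?l * \<Delta> $ i\<bar> powr p)"
    using lp_pow_sum[of "x - ?l \<cdot>\<^sub>v \<Delta>" m p] x d by (simp cong: sum.cong_simp)
  also have "\<dots> \<le> (\<Sum>i<m. \<bar>x $ i\<bar> powr p - ?l * (p * \<bar>x $ i\<bar> powr (p - 2) * x $ i * \<Delta> $ i
           - (p - 1) / (p * 2 powr p) * gamma_fun p \<bar>x $ i\<bar> (\<Delta> $ i)))"
  proof (rule sum_mono)
    fix i
    let ?g = "gamma_fun p \<bar>x $ i\<bar>" and ?a = "p * \<bar>x $ i\<bar> powr (p - 2) * x $ i"
    have "\<bar>x $ i - ?l * \<Delta> $ i\<bar> powr p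
        \<le> \<bar>x $ i\<bar> powr p - ?a * (?l * \<Delta> $ i) + 2 powr p * ?g (?l * \<Delta> $ i)"
      using abs_powr_deviation_bounds(2)[OF p, of "x $ i" "?l * \<Delta> $ i"] by simp
    also have "2 powr p * ?g (?l * \<Delta> $ i) \<le> 2 powr p * (?l powr (1 + min 1 (p - 1)) * ?g (\<Delta> $ i))"
      using step_size_bounds[OF p] p by (intro mult_left_mono gamma_fun_contract) auto
    also have "\<dots> = ?l * ((p - 1) / (p * 2 powr p)) * ?g (\<Delta> $ i)"
      using step_size_powr[OF p] by (simp only: mult.assoc[symmetric])
    finally show "\<bar>x $ i - ?l * \<Delta> $ i\<bar> powr p \<le> \<bar>x $ i\<bar> powr p - ?l * (?a * \<Delta> $ i
           - (p - 1) / (p * 2 powr p) * ?g (\<Delta> $ i))"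
      by (simp only: right_diff_distrib) (simp add: mult_ac)
  qed
  also have "\<dots> = lp_pow p x - ?l * residual p x \<Delta>"
    unfolding lp_pow_sum[OF x] residual_sum[OF x d] sum_distrib_left by (rule sum_subtractf)
  finally show ?thesis .
qed


section \<open>Optimal value, feasibility and progress of the loop\<close>

lemma OPT_le: "y \<in> feasible A b \<Longrightarrow> OPT p A b \<le> lp_pow p y"
  unfolding OPT_def by (rule cINF_lower) (auto intro: bdd_belowI2[where m = 0] lp_pow_nonneg)

lemma OPT_greatest:
  "feasible A b \<noteq> {} \<Longrightarrow> (\<And>y. y \<in> feasible A b \<Longrightarrow> k \<le> lp_pow p y) \<Longrightarrow> k \<le> OPT p A b"
  unfolding OPT_def by (rule cINF_greatest)

lemma feasible_diff:
  assumes "x \<in> feasible A b" "y \<in> feasible A b"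
  shows "x - y \<in> feasible A (0\<^sub>v (dim_row A))"
proof -
  have A: "A \<in> carrier_mat (dim_row A) (dim_col A)" by simp
  have "A *\<^sub>v (x - y) = A *\<^sub>v x - A *\<^sub>v y"
    using assms by (intro mult_minus_distrib_mat_vec[OF A]) (auto simp: feasible_def)
  also have "\<dots> = 0\<^sub>v (dim_row A)"
    using assms by (intro eq_vecI) (auto simp: feasible_def)
  finally show ?thesis using assms by (auto simp: feasible_def)
qed

lemma feasible_step:
  assumes "x \<in> feasible A b" "\<Delta> \<in> feasible A (0\<^sub>v (dim_row A))"
  shows "x - l \<cdot>\<^sub>v \<Delta> \<in> feasible A b"
proof -
  have A: "A \<in> carrier_mat (dim_row A) (dim_col A)" by simp
  have "A *\<^sub>v (x - l \<cdot>\<^sub>v \<Delta>) = A *\<^sub>v x - A *\<^sub>v (l \<cdot>\<^sub>v \<Delta>)"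
    using assms by (intro mult_minus_distrib_mat_vec[OF A]) (auto simp: feasible_def)
  also have "A *\<^sub>v (l \<cdot>\<^sub>v \<Delta>) = l \<cdot>\<^sub>v (A *\<^sub>v \<Delta>)"
    using assms by (intro mult_mat_vec[OF A]) (auto simp: feasible_def)
  also have "A *\<^sub>v x - l \<cdot>\<^sub>v (A *\<^sub>v \<Delta>) = b"
    using assms by (intro eq_vecI) (auto simp: feasible_def)
  finally show ?thesis using assms by (auto simp: feasible_def)
qed

text \<open>The optimal residual dominates the one at \<open>x - y\<close> for each feasible
  \<open>y\<close>, hence the gap; the approximate solver loses a factor \<open>\<kappa>\<close>,
  and the step realises \<open>step_size p\<close> of the rest.\<close>

lemma refinement_step_progress:
  assumes p: "1 < p" and \<kappa>: "1 \<le> \<kappa>" and x: "x \<in> feasible A b"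
    and \<Delta>: "residual_approx p A \<kappa> x \<Delta>"
  shows "step_size p / \<kappa> * (lp_pow p x - OPT p A b) \<le> lp_pow p x - lp_pow p (x - step_size p \<cdot>\<^sub>v \<Delta>)"
proof -
  obtain \<Delta>' where opt: "residual_optimal p A x \<Delta>'"
    and ge: "1 / \<kappa> * residual p x \<Delta>' \<le> residual p x \<Delta>"
    using \<Delta> by (auto simp: residual_approx_def)
  have "lp_pow p x - residual p x \<Delta>' \<le> OPT p A b"
  proof (rule OPT_greatest)
    show "feasible A b \<noteq> {}" using x by auto
    fix y assume y: "y \<in> feasible A b"
    have "residual p x (x - y) \<le> residual p x \<Delta>'"
      using opt feasible_diff[OF x y]
      by (auto simp: residual_optimal_def is_arg_max_linorder)
    then show "lp_pow p x - residual p x \<Delta>' \<le> lp_pow p y"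
      using lp_pow_diff_le_residual[OF p, of x "dim_col A" y] x y by (auto simp: feasible_def)
  qed
  then have "1 / \<kappa> * (lp_pow p x - OPT p A b) \<le> 1 / \<kappa> * residual p x \<Delta>'"
    using \<kappa> by (intro mult_left_mono) auto
  also note ge
  finally have "step_size p * (1 / \<kappa> * (lp_pow p x - OPT p A b)) \<le> step_size p * residual p x \<Delta>"
    using step_size_bounds[OF p] by (intro mult_left_mono) auto
  then show ?thesis
    using lp_pow_step_le[OF p, of x "dim_col A" \<Delta>] x \<Delta>
    by (auto simp: residual_approx_def feasible_def)
qed

text \<open>Induction on the remaining passes. The exponent is one less than the largest possible
  number of calls, since pass \<open>T\<close> returns the iterate from before its step.\<close>

lemma refinement_loop_progress:
  assumes p: "1 < p" and \<kappa>: "1 \<le> \<kappa>" and solve: "approx_solver p A b \<kappa> solve"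
    and "x \<in> feasible A b" and "t \<le> T" and "refinement_loop p solve T t x = (y, calls)"
  shows "y \<in> feasible A b \<and> calls \<le> T - t + 1 \<and>
    lp_pow p y - OPT p A b \<le> (1 - step_size p / \<kappa>) ^ (T - t) * (lp_pow p x - OPT p A b)"
  using assms(4-)
proof (induction "T - t" arbitrary: t x calls)
  case 0
  then show ?case
    by (subst (asm) refinement_loop.simps) (auto simp: Let_def split: if_splits)
next
  case (Suc k)
  let ?l = "step_size p"
  define x' where "x' = x - ?l \<cdot>\<^sub>v solve t x"
  let ?gap = "\<lambda>x. lp_pow p x - OPT p A b"
  have approx: "residual_approx p A \<kappa> x (solve t x)"
    using solve Suc.prems by (auto simp: approx_solver_def)
  have progress: "?l / \<kappa> * ?gap x \<le> lp_pow p x - lp_pow p x'"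
    unfolding x'_def by (rule refinement_step_progress[OF p \<kappa> Suc.prems(1) approx])
  have l: "0 < ?l / \<kappa>" "?l / \<kappa> \<le> 1"
    using step_size_bounds[OF p] \<kappa> by (auto simp: divide_le_eq)
  have gap: "0 \<le> ?gap x" using OPT_le[OF Suc.prems(1)] by simp
  show ?case
  proof (cases "lp_pow p x \<le> lp_pow p x'")
    case True
    then have "(y, calls) = (x, 1)"
      using Suc.prems(3) by (subst (asm) refinement_loop.simps) (simp add: Let_def x'_def)
    \<comment> \<open>A positive gap would force a strict decrease, so an early stop happens only at
      an optimum.\<close>
    moreover have "?gap x \<le> 0"
      using True progress l mult_pos_pos[of "?l / \<kappa>" "?gap x"] by linarith
    moreover have "0 \<le> (1 - ?l / \<kappa>) ^ (T - t) * ?gap x"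
      using l gap by (intro mult_nonneg_nonneg) auto
    ultimately show ?thesis using Suc.prems(1) by auto
  next
    case False
    have t: "t < T" using Suc.hyps(2) by simp
    obtain calls' where rec: "refinement_loop p solve T (Suc t) x' = (y, calls')"
      and calls: "calls = Suc calls'"
      using Suc.prems(3) False t
      by (subst (asm) refinement_loop.simps) (auto simp: Let_def x'_def split: prod.splits)
    have "x' \<in> feasible A b"
      unfolding x'_def using approx by (intro feasible_step[OF Suc.prems(1)]) (simp add: residual_approx_def)
    then have IH: "y \<in> feasible A b" "calls' \<le> T - Suc t + 1"
        "?gap y \<le> (1 - ?l / \<kappa>) ^ (T - Suc t) * ?gap x'"
      using Suc.hyps(1)[of "Suc t" x' calls'] Suc.hyps(2) t rec by auto
    note IH(3)
    also have "(1 - ?l / \<kappa>) ^ (T - Suc t) * ?gap x' \<le>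
        (1 - ?l / \<kappa>) ^ (T - Suc t) * ((1 - ?l / \<kappa>) * ?gap x)"
      using progress l by (intro mult_left_mono) (auto simp: left_diff_distrib)
    also have "\<dots> = (1 - ?l / \<kappa>) ^ Suc (T - Suc t) * ?gap x" by simp
    also have "Suc (T - Suc t) = T - t" using t by simp
    finally show ?thesis using IH calls t by auto
  qed
qed

section \<open>Quality of the starting point and number of passes\<close>

text \<open>
  The exponent \<open>1 + p / 2\<close> is not sharp (Hoelder gives \<open>\<bar>p / 2 - 1\<bar>\<close>), but any exponent
  depending only on \<open>p\<close> is absorbed into the constant of the iteration count.
\<close>

lemma lp_pow_le_lp_pow_of_l2_le:
  assumes p: "1 < p" and x: "x \<in> carrier_vec m" and y: "y \<in> carrier_vec m"
    and le: "lp_pow 2 x \<le> lp_pow 2 y"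
  shows "lp_pow p x \<le> real m powr (1 + p / 2) * lp_pow p y"
proof -
  have half: "(\<bar>a\<bar> powr 2) powr (p / 2) = \<bar>a\<bar> powr p" for a :: real
    by (simp only: powr_powr) simp
  \<comment> \<open>Both norms are compared through single coordinates: bounding the 2-norm of
    \<open>y\<close> costs \<open>m powr (p / 2)\<close>, bounding the \<open>p\<close>-th powers of
    \<open>x\<close> a further \<open>m\<close>.\<close>
  have coord: "\<bar>y $ i\<bar> powr 2 \<le> lp_pow p y powr (2 / p)" if "i < m" for i
  proof -
    have "\<bar>y $ i\<bar> powr p \<le> lp_pow p y"
      unfolding lp_pow_sum[OF y] using that by (intro member_le_sum) auto
    then have "(\<bar>y $ i\<bar> powr p) powr (2 / p) \<le> lp_pow p y powr (2 / p)"
      using p by (intro powr_mono2) auto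
    then show ?thesis using p by (simp only: powr_powr) simp
  qed
  have "lp_pow 2 y \<le> (\<Sum>i<m. lp_pow p y powr (2 / p))"
    unfolding lp_pow_sum[OF y, of 2] using coord by (intro sum_mono) auto
  then have "lp_pow 2 x \<le> real m * lp_pow p y powr (2 / p)" using le by simp
  then have "lp_pow 2 x powr (p / 2) \<le> (real m * lp_pow p y powr (2 / p)) powr (p / 2)"
    using p by (intro powr_mono2) (auto simp: lp_pow_nonneg)
  also have "\<dots> = real m powr (p / 2) * lp_pow p y"
    using p lp_pow_nonneg[of p y] by (simp add: powr_mult powr_powr)
  finally have bound: "lp_pow 2 x powr (p / 2) \<le> real m powr (p / 2) * lp_pow p y" .
  have "lp_pow p x \<le> (\<Sum>i<m. lp_pow 2 x powr (p / 2))"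
    unfolding lp_pow_sum[OF x, of p]
  proof (rule sum_mono)
    fix i assume "i \<in> {..<m}"
    then have "\<bar>x $ i\<bar> powr 2 \<le> lp_pow 2 x"
      unfolding lp_pow_sum[OF x, of 2] by (intro member_le_sum) auto
    then have "(\<bar>x $ i\<bar> powr 2) powr (p / 2) \<le> lp_pow 2 x powr (p / 2)"
      using p by (intro powr_mono2) auto
    then show "\<bar>x $ i\<bar> powr p \<le> lp_pow 2 x powr (p / 2)" by (simp only: half)
  qed
  also have "\<dots> = real m * lp_pow 2 x powr (p / 2)" by simp
  also have "\<dots> \<le> real m * (real m powr (p / 2) * lp_pow p y)"
    using bound by (intro mult_left_mono) auto
  also have "\<dots> = real m powr (1 + p / 2) * lp_pow p y"
    by (cases "m = 0") (auto simp: powr_add)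
  finally show ?thesis .
qed

text \<open>From \<open>1 - l \<le> exp (- l)\<close>. In the factor \<open>a + 1\<close>, the part
  \<open>a\<close> pays for \<open>M powr a\<close> and the \<open>1\<close> for
  \<open>\<epsilon>\<close>; the surplus \<open>ln M - a * ln \<epsilon>\<close> is
  nonnegative.\<close>

lemma contraction_reaches_accuracy:
  fixes l a M \<epsilon> :: real
  assumes l: "0 < l" "l \<le> 1" and a: "0 \<le> a" and M: "1 \<le> M" and \<epsilon>: "0 < \<epsilon>" "\<epsilon> \<le> 1"
    and T: "(a + 1) / l * ln (M / \<epsilon>) \<le> real T"
  shows "(1 - l) ^ T * M powr a \<le> \<epsilon>"
proof -
  have "(1 - l) ^ T \<le> exp (- l) ^ T"
    using exp_ge_add_one_self[of "- l"] l by (intro power_mono) auto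
  also have "\<dots> = exp (- (l * real T))" by (simp add: exp_of_nat_mult[symmetric] mult.commute)
  also have "\<dots> \<le> exp (- ((a + 1) * ln (M / \<epsilon>)))"
    using T l by (simp add: field_simps)
  also have "\<dots> \<le> exp (- (a * ln M) + ln \<epsilon>)"
  proof -
    have "0 \<le> ln M" "ln \<epsilon> \<le> 0" using M \<epsilon> by auto
    then have "a * ln \<epsilon> \<le> ln M" using a mult_nonneg_nonpos[of a "ln \<epsilon>"] by linarith
    then show ?thesis
      using M \<epsilon> by (simp add: ln_div algebra_simps)
  qed
  also have "\<dots> = \<epsilon> / M powr a"
    using M \<epsilon> by (simp add: exp_diff powr_def)
  finally have "(1 - l) ^ T \<le> \<epsilon> / M powr a" .
  then show ?thesis using M by (simp add: field_simps)
qed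

text \<open>The constants precede all other data, so they depend on \<open>p\<close> alone. The
  bound on \<open>calls\<close> assumes \<open>2 \<le> real m / \<epsilon>\<close> because the
  logarithm vanishes at \<open>m = \<epsilon> = 1\<close>, while one call is always made.\<close>

theorem theorem4p1:
  fixes p :: real
  assumes "1 < p"
  shows "\<exists>C > 0. \<exists>C' > 0.
    \<forall>(\<kappa> :: real) (\<epsilon> :: real) (m :: nat) (n :: nat) (A :: real mat) (b :: real vec)
      (x0 :: real vec) (solve :: nat \<Rightarrow> real vec \<Rightarrow> real vec) (T :: nat) (x :: real vec) (calls :: nat).
      1 \<le> \<kappa> \<longrightarrow> 0 < \<epsilon> \<longrightarrow> \<epsilon> \<le> 1 \<longrightarrow> 1 \<le> m \<longrightarrow> n \<le> m \<longrightarrow>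
      A \<in> carrier_mat n m \<longrightarrow> b \<in> carrier_vec n \<longrightarrow>
      is_arg_min (lp_pow 2) (\<lambda>x. x \<in> feasible A b) x0 \<longrightarrow>
      approx_solver p A b \<kappa> solve \<longrightarrow>
      T = nat \<lceil>C * \<kappa> * ln (real m / \<epsilon>)\<rceil> \<longrightarrow>
      iterative_refinement p solve T x0 = (x, calls) \<longrightarrow>
        eps_approx_solution p A b \<epsilon> x \<and>
        calls \<le> T + 1 \<and>
        (2 \<le> real m / \<epsilon> \<longrightarrow> real calls \<le> C' * \<kappa> * ln (real m / \<epsilon>))"
proof -
  define l where "l = step_size p"
  \<comment> \<open>This is \<open>(a + 1) / l\<close> for the exponent \<open>a = 1 + p / 2\<close>
    of the starting bound; \<open>\<kappa>\<close> enters through the rate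
    \<open>l / \<kappa>\<close>.\<close>
  define C where "C = (2 + p / 2) / l"
  \<comment> \<open>The summand \<open>2 / ln 2\<close> pays for two extra calls, one from rounding
    up and one from pass \<open>T\<close>.\<close>
  define C' where "C' = C + 2 / ln 2"
  have l: "0 < l" "l \<le> 1" using step_size_bounds[OF assms] by (auto simp: l_def)
  have C: "0 < C" using l assms by (simp add: C_def)
  have C': "0 < C'" using C by (simp add: C'_def add_pos_pos)
  show ?thesis
  proof (rule exI[of _ C], rule conjI[OF C], rule exI[of _ C'], rule conjI[OF C'], intro allI impI)
    fix \<kappa> \<epsilon> :: real and m n :: nat and A :: "real mat" and b x0 x :: "real vec"
      and solve :: "nat \<Rightarrow> real vec \<Rightarrow> real vec" and T calls :: nat
    assume \<kappa>: "1 \<le> \<kappa>" and \<epsilon>: "0 < \<epsilon>" "\<epsilon> \<le> 1" and m: "1 \<le> m"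
      and A: "A \<in> carrier_mat n m"
      and x0: "is_arg_min (lp_pow 2) (\<lambda>x. x \<in> feasible A b) x0"
      and solve: "approx_solver p A b \<kappa> solve"
      and T: "T = nat \<lceil>C * \<kappa> * ln (real m / \<epsilon>)\<rceil>"
      and run: "iterative_refinement p solve T x0 = (x, calls)"
    let ?L = "ln (real m / \<epsilon>)" and ?M = "real m powr (1 + p / 2)"
    have L: "0 \<le> ?L" using m \<epsilon> by (simp add: field_simps)
    have x0f: "x0 \<in> feasible A b"
      and x0min: "\<And>y. y \<in> feasible A b \<Longrightarrow> lp_pow 2 x0 \<le> lp_pow 2 y"
      using x0 by (auto simp: is_arg_min_linorder)
    have loop: "x \<in> feasible A b" "calls \<le> T + 1"
        "lp_pow p x - OPT p A b \<le> (1 - l / \<kappa>) ^ T * (lp_pow p x0 - OPT p A b)"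
      using refinement_loop_progress[OF assms \<kappa> solve x0f, of 0 T x calls] run
      by (auto simp: iterative_refinement_def l_def)
    \<comment> \<open>The quotient form makes this a lower bound for every feasible value, hence for
      the infimum.\<close>
    have "lp_pow p x0 / ?M \<le> OPT p A b"
    proof (rule OPT_greatest)
      fix y assume y: "y \<in> feasible A b"
      have "lp_pow p x0 \<le> ?M * lp_pow p y"
        using x0f y A x0min[OF y] by (intro lp_pow_le_lp_pow_of_l2_le[OF assms]) (auto simp: feasible_def)
      then show "lp_pow p x0 / ?M \<le> lp_pow p y" using m by (simp add: field_simps)
    qed (use x0f in auto)
    then have x0le: "lp_pow p x0 \<le> ?M * OPT p A b" using m by (simp add: field_simps)
    have opt: "0 \<le> OPT p A b" using x0f by (intro OPT_greatest) (auto simp: lp_pow_nonneg)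
    have lk: "0 < l / \<kappa>" "l / \<kappa> \<le> 1" using l \<kappa> by (auto simp: divide_le_eq)
    have "C * \<kappa> * ?L = (1 + p / 2 + 1) / (l / \<kappa>) * ?L" by (simp add: C_def)
    then have "(1 + p / 2 + 1) / (l / \<kappa>) * ?L \<le> real T"
      unfolding T by linarith
    then have contract: "(1 - l / \<kappa>) ^ T * ?M \<le> \<epsilon>"
      using assms m \<epsilon> by (intro contraction_reaches_accuracy[OF lk]) auto
    have "(1 - l / \<kappa>) ^ T * (lp_pow p x0 - OPT p A b) \<le> (1 - l / \<kappa>) ^ T * (?M * OPT p A b)"
      using x0le opt lk by (intro mult_left_mono) auto
    also have "\<dots> \<le> \<epsilon> * OPT p A b"
      using mult_right_mono[OF contract opt] by (simp add: mult.assoc)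
    finally have "lp_pow p x \<le> (1 + \<epsilon>) * OPT p A b"
      using loop(3) by (simp add: distrib_right)
    moreover have "real calls \<le> C' * \<kappa> * ?L" if "2 \<le> real m / \<epsilon>"
    proof -
      have "ln 2 \<le> ?L" using that by simp
      then have "1 * ln 2 \<le> \<kappa> * ?L" using \<kappa> L by (intro mult_mono) auto
      then have "2 \<le> 2 / ln 2 * (\<kappa> * ?L)" by (simp add: field_simps)
      moreover have "0 \<le> C * \<kappa> * ?L" using C \<kappa> L by simp
      then have "real T \<le> C * \<kappa> * ?L + 1" unfolding T by linarith
      ultimately show ?thesis using loop(2) by (simp add: C'_def distrib_right)
    qed
    ultimately show "eps_approx_solution p A b \<epsilon> x \<and> calls \<le> T + 1 \<and>
        (2 \<le> real m / \<epsilon> \<longrightarrow> real calls \<le> C' * \<kappa> * ?L)"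
      using loop by (auto simp: eps_approx_solution_def)
  qed
qed

end
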